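(* Let $V=V_{\bar 0}\oplus V_{\bar 1}$ be a finite dimensional $\mathbb Z_2$-graded vector space over $\mathbb K$ ($\mathbb K=\mathbb R$ or $\mathbb C$) with a non-degenerate even skew-symmetric bilinear form $(\,,)$, and let $n\ge 1$. Then every commutative $n$-ary superalgebra structure on $V$ that is invariant with respect to $(\,,)$ can be obtained by the derived bracket construction, i.e. there is $\mu\in S^{n+1}V$ such that $$\{a_1,\ldots,a_n\}=[a_1,[a_2,\ldots,[a_n,\mu]\ldots]]\qquad\text{for all } a_1,\ldots,a_n\in V.$$
   Context: For homogeneous $a\in V$, $\bar a\in\mathbb Z_2$ denotes its parity; scalars are even. A bilinear form on $V$ is even if the corresponding linear map $V\otimes V\to\mathbb K$ is even (so $(V_{\bar 0},V_{\bar 1})=0$), and skew-symmetric if $(a,b)=-(-1)^{\bar a\bar b}(b,a)$ for homogeneous $a,b$. An $n$-ary superalgebra structure on $V$ is an $n$-linear map $V\times\cdots\times V\to V$, $(a_1,\ldots,a_n)\mapsto\{a_1,\ldots,a_n\}$. It is commutative if $\{a_1,\ldots,a_i,a_{i+1},\ldots,a_n\}=(-1)^{\bar a_i\bar a_{i+1}}\{a_1,\ldots,a_{i+1},a_i,\ldots,a_n\}$ for homogeneous elements. A commutative structure is invariant with respect to $(\,,)$ if $(a_0,\{a_1,\ldots,a_n\})=(-1)^{\bar a_0\bar a_1}(a_1,\{a_0,a_2,\ldots,a_n\})$ for all homogeneous $a_0,\ldots,a_n\in V$. $S^nV$ is the $n$-th (super)symmetric power of $V$ and $S^*V=\bigoplus_n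 S^nV$, with $S^0V=\mathbb K$. It carries the Poisson superalgebra bracket $[\,,]$ (bilinear, zero when one argument is a scalar) determined by $[x,y]=(x,y)$ for $x,y\in V$, $[v,w_1w_2]=[v,w_1]w_2+(-1)^{\bar v\bar w_1}w_1[v,w_2]$ and $[v,w]=-(-1)^{\bar v\bar w}[w,v]$ for homogeneous $v,w,w_1,w_2\in S^*V$. *)

theory Defs
  imports
    "HOL-Library.Z2"
    "HOL-Library.Poly_Mapping"
    "HOL-Algebra.Algebraic_Closure_Type"
begin

class real_or_complex = field +
  assumes real_or_complex:
    "(\<exists>f :: 'a \<Rightarrow> real. bij f \<and>
        (\<forall>x y. f (x + y) = f x + f y \<and> f (x * y) = f x * f y)) \<or>
     (\<exists>f :: 'a \<Rightarrow> complex. bij f \<and>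
        (\<forall>x y. f (x + y) = f x + f y \<and> f (x * y) = f x * f y))"

instance real :: real_or_complex
  by (intro_classes, rule disjI1, rule exI[of _ id]) simp

instance complex :: real_or_complex
  by (intro_classes, rule disjI2, rule exI[of _ id]) simp

text \<open>A \<open>\<int>\<^sub>2\<close>-grading is a family \<open>V\<close> of subspaces indexed by \<open>bit\<close>, the field with two
  elements: \<open>V 0\<close> is the even and \<open>V 1\<close> the odd part. Thus \<open>p * q\<close> and \<open>p + q\<close> below are
  computed modulo 2. The zero vector lies in both components.\<close>

locale super_vector_space = vector_space scale
  for scale :: "'k::field \<Rightarrow> 'v::ab_group_add \<Rightarrow> 'v" +
  fixes V :: "bit \<Rightarrow> 'v set"
  assumes subspace_component: "subspace (V p)"
    and components_Int: "V 0 \<inter> V 1 = {0}"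
    and components_sum: "\<exists>a\<in>V 0. \<exists>b\<in>V 1. x = a + b"

definition homogeneous :: "(bit \<Rightarrow> 'v set) \<Rightarrow> 'v set" where
  "homogeneous V = V 0 \<union> V 1"

definition parity_sign :: "bit \<Rightarrow> 'k::ring_1" where
  "parity_sign p = (if p = 0 then 1 else - 1)"

definition bilinear_form ::
  "('k::field \<Rightarrow> 'v::ab_group_add \<Rightarrow> 'v) \<Rightarrow> ('v \<Rightarrow> 'v \<Rightarrow> 'k) \<Rightarrow> bool" where
  "bilinear_form scale B \<longleftrightarrow>
     (\<forall>y. Vector_Spaces.linear scale (*) (\<lambda>x. B x y)) \<and>
     (\<forall>x. Vector_Spaces.linear scale (*) (\<lambda>y. B x y))"

definition even_form :: "(bit \<Rightarrow> 'v set) \<Rightarrow> ('v \<Rightarrow> 'v \<Rightarrow> 'k::field) \<Rightarrow> bool" where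
  "even_form V B \<longleftrightarrow> (\<forall>p q. \<forall>a\<in>V p. \<forall>b\<in>V q. p \<noteq> q \<longrightarrow> B a b = 0)"

definition super_skew_symmetric :: "(bit \<Rightarrow> 'v set) \<Rightarrow> ('v \<Rightarrow> 'v \<Rightarrow> 'k::field) \<Rightarrow> bool" where
  "super_skew_symmetric V B \<longleftrightarrow>
     (\<forall>p q. \<forall>a\<in>V p. \<forall>b\<in>V q. B a b = - (parity_sign (p * q) * B b a))"

definition nondegenerate :: "('v::zero \<Rightarrow> 'v \<Rightarrow> 'k::field) \<Rightarrow> bool" where
  "nondegenerate B \<longleftrightarrow>
     (\<forall>x. (\<forall>y. B x y = 0) \<longrightarrow> x = 0) \<and> (\<forall>y. (\<forall>x. B x y = 0) \<longrightarrow> y = 0)"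

text \<open>An \<open>n\<close>-ary operation is a function on lists, of which only the values on lists of
  length \<open>n\<close> matter.\<close>

definition n_linear ::
  "('k::field \<Rightarrow> 'v::ab_group_add \<Rightarrow> 'v) \<Rightarrow> nat \<Rightarrow> ('v list \<Rightarrow> 'v) \<Rightarrow> bool" where
  "n_linear scale n m \<longleftrightarrow>
     (\<forall>xs ys. length xs + 1 + length ys = n \<longrightarrow>
        Vector_Spaces.linear scale scale (\<lambda>a. m (xs @ a # ys)))"

definition super_commutative ::
  "('k::field \<Rightarrow> 'v \<Rightarrow> 'v) \<Rightarrow> (bit \<Rightarrow> 'v set) \<Rightarrow> nat \<Rightarrow> ('v list \<Rightarrow> 'v) \<Rightarrow> bool" where
  "super_commutative scale V n m \<longleftrightarrow>
     (\<forall>p q. \<forall>a\<in>V p. \<forall>b\<in>V q. \<forall>xs ys.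
        set xs \<subseteq> homogeneous V \<longrightarrow> set ys \<subseteq> homogeneous V \<longrightarrow>
        length xs + 2 + length ys = n \<longrightarrow>
        m (xs @ a # b # ys) = scale (parity_sign (p * q)) (m (xs @ b # a # ys)))"

definition invariant_structure ::
  "(bit \<Rightarrow> 'v set) \<Rightarrow> ('v \<Rightarrow> 'v \<Rightarrow> 'k::field) \<Rightarrow> nat \<Rightarrow> ('v list \<Rightarrow> 'v) \<Rightarrow> bool" where
  "invariant_structure V B n m \<longleftrightarrow>
     (\<forall>p q. \<forall>a\<in>V p. \<forall>b\<in>V q. \<forall>xs.
        set xs \<subseteq> homogeneous V \<longrightarrow> 1 + length xs = n \<longrightarrow>
        B a (m (b # xs)) = parity_sign (p * q) * B b (m (a # xs)))"

text \<open>The free monoid on a type, so that \<open>'v word \<Rightarrow>\<^sub>0 'k\<close> with the product of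
  Poly-Mapping is the free associative unital \<open>'k\<close>-algebra on the set \<open>'v\<close>.\<close>

datatype 'v word = Word (letters: "'v list")

instantiation word :: (type) monoid_add
begin

definition zero_word :: "'a word" where
  "0 = Word []"

definition plus_word :: "'a word \<Rightarrow> 'a word \<Rightarrow> 'a word" where
  "u + w = Word (letters u @ letters w)"

instance
  by intro_classes (simp_all add: zero_word_def plus_word_def)

end

type_synonym ('v, 'k) free_alg = "'v word \<Rightarrow>\<^sub>0 'k"

definition gen :: "'v \<Rightarrow> ('v, 'k::field) free_alg" where
  "gen a = Poly_Mapping.single (Word [a]) 1"

definition const :: "'k \<Rightarrow> ('v, 'k::field) free_alg" where
  "const c = Poly_Mapping.single 0 c"

text \<open>Modulo the first two families of relations the free algebra is the tensor algebra of
  the vector space; the third one imposes supercommutativity.\<close>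

definition super_relations ::
  "('k::field \<Rightarrow> 'v::ab_group_add \<Rightarrow> 'v) \<Rightarrow> (bit \<Rightarrow> 'v set) \<Rightarrow> ('v, 'k) free_alg set" where
  "super_relations scale V =
     {gen (a + b) - gen a - gen b | a b. True} \<union>
     {gen (scale c a) - const c * gen a | c a. True} \<union>
     {gen a * gen b - const (parity_sign (p * q)) * gen b * gen a | a b p q. a \<in> V p \<and> b \<in> V q}"

definition super_ideal ::
  "('k::field \<Rightarrow> 'v::ab_group_add \<Rightarrow> 'v) \<Rightarrow> (bit \<Rightarrow> 'v set) \<Rightarrow> ('v, 'k) free_alg set" where
  "super_ideal scale V = genideal ring_of_type_algebra (super_relations scale V)"

definition sym_alg ::
  "('k::field \<Rightarrow> 'v::ab_group_add \<Rightarrow> 'v) \<Rightarrow> (bit \<Rightarrow> 'v set) \<Rightarrow> ('v, 'k) free_alg set ring" where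
  "sym_alg scale V = ring_of_type_algebra Quot super_ideal scale V"

definition sym_class ::
  "('k::field \<Rightarrow> 'v::ab_group_add \<Rightarrow> 'v) \<Rightarrow> (bit \<Rightarrow> 'v set) \<Rightarrow>
   ('v, 'k) free_alg \<Rightarrow> ('v, 'k) free_alg set" where
  "sym_class scale V t = a_r_coset ring_of_type_algebra (super_ideal scale V) t"

text \<open>The embeddings of \<open>V\<close> as \<open>S\<^sup>1V\<close> and of the ground field as \<open>S\<^sup>0V\<close>.\<close>

definition sym_incl ::
  "('k::field \<Rightarrow> 'v::ab_group_add \<Rightarrow> 'v) \<Rightarrow> (bit \<Rightarrow> 'v set) \<Rightarrow> 'v \<Rightarrow> ('v, 'k) free_alg set" where
  "sym_incl scale V a = sym_class scale V (gen a)"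

definition sym_scalar ::
  "('k::field \<Rightarrow> 'v::ab_group_add \<Rightarrow> 'v) \<Rightarrow> (bit \<Rightarrow> 'v set) \<Rightarrow> 'k \<Rightarrow> ('v, 'k) free_alg set" where
  "sym_scalar scale V c = sym_class scale V (const c)"

definition sym_power ::
  "('k::field \<Rightarrow> 'v::ab_group_add \<Rightarrow> 'v) \<Rightarrow> (bit \<Rightarrow> 'v set) \<Rightarrow> nat \<Rightarrow>
   ('v, 'k) free_alg set set" where
  "sym_power scale V n =
     {sym_class scale V t | t. \<forall>w\<in>Poly_Mapping.keys t. length (letters w) = n}"

text \<open>The induced \<open>\<int>\<^sub>2\<close>-grading of \<open>S\<^sup>*V\<close>: a product of homogeneous vectors has as its
  parity the sum of their parities.\<close>

definition has_parity :: "(bit \<Rightarrow> 'v set) \<Rightarrow> bit \<Rightarrow> 'v word \<Rightarrow> bool" where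
  "has_parity V p w \<longleftrightarrow>
     (\<exists>ps. list_all2 (\<lambda>a q. a \<in> V q) (letters w) ps \<and> sum_list ps = p)"

definition sym_component ::
  "('k::field \<Rightarrow> 'v::ab_group_add \<Rightarrow> 'v) \<Rightarrow> (bit \<Rightarrow> 'v set) \<Rightarrow> bit \<Rightarrow>
   ('v, 'k) free_alg set set" where
  "sym_component scale V p =
     {sym_class scale V t | t. \<forall>w\<in>Poly_Mapping.keys t. has_parity V p w}"

text \<open>Multiplication of \<open>u\<close> by a scalar \<open>c\<close> in \<open>S\<^sup>*V\<close> is multiplication by the class of the
  constant \<open>c\<close>. The properties listed determine the bracket on \<open>S\<^sup>*V\<close>; its being even and the super
  Jacobi identity follow from them. Values outside the carrier are irrelevant.\<close>

locale poisson_bracket =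
  fixes scale :: "'k::field \<Rightarrow> 'v::ab_group_add \<Rightarrow> 'v"
    and V :: "bit \<Rightarrow> 'v set"
    and B :: "'v \<Rightarrow> 'v \<Rightarrow> 'k"
    and br :: "('v, 'k) free_alg set \<Rightarrow> ('v, 'k) free_alg set \<Rightarrow> ('v, 'k) free_alg set"
    and S (structure)
  defines "S \<equiv> sym_alg scale V"
  assumes br_closed: "\<lbrakk>u \<in> carrier S; w \<in> carrier S\<rbrakk> \<Longrightarrow> br u w \<in> carrier S"
    and br_add_left: "\<lbrakk>u \<in> carrier S; v \<in> carrier S; w \<in> carrier S\<rbrakk> \<Longrightarrow>
      br (u \<oplus> v) w = br u w \<oplus> br v w"
    and br_add_right: "\<lbrakk>u \<in> carrier S; v \<in> carrier S; w \<in> carrier S\<rbrakk> \<Longrightarrow>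
      br w (u \<oplus> v) = br w u \<oplus> br w v"
    and br_scale_left: "\<lbrakk>u \<in> carrier S; w \<in> carrier S\<rbrakk> \<Longrightarrow>
      br (sym_scalar scale V c \<otimes> u) w = sym_scalar scale V c \<otimes> br u w"
    and br_scale_right: "\<lbrakk>u \<in> carrier S; w \<in> carrier S\<rbrakk> \<Longrightarrow>
      br u (sym_scalar scale V c \<otimes> w) = sym_scalar scale V c \<otimes> br u w"
    and br_scalar_left: "u \<in> carrier S \<Longrightarrow> br (sym_scalar scale V c) u = \<zero>"
    and br_scalar_right: "u \<in> carrier S \<Longrightarrow> br u (sym_scalar scale V c) = \<zero>"
    and br_incl: "br (sym_incl scale V x) (sym_incl scale V y) = sym_scalar scale V (B x y)"
    and br_leibniz:
      "\<lbrakk>v \<in> sym_component scale V p; w1 \<in> sym_component scale V q; w2 \<in> sym_component scale V r\<rbrakk> \<Longrightarrow>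
        br v (w1 \<otimes> w2) =
          br v w1 \<otimes> w2 \<oplus> sym_scalar scale V (parity_sign (p * q)) \<otimes> w1 \<otimes> br v w2"
    and br_skew:
      "\<lbrakk>v \<in> sym_component scale V p; w \<in> sym_component scale V q\<rbrakk> \<Longrightarrow>
        br v w = \<ominus> (sym_scalar scale V (parity_sign (p * q)) \<otimes> br w v)"

end

theory Submission
  imports Defs
begin

text \<open>By invariance and commutativity \<open>f (a\<^sub>0, \<dots>, a\<^sub>n) = (a\<^sub>0, {a\<^sub>1, \<dots>, a\<^sub>n})\<close> is a
  supersymmetric multilinear form. Take homogeneous bases \<open>e\<close> and \<open>dual e\<close> of the space with
  \<open>(e, dual e') = 1\<close> if \<open>e = e'\<close> and \<open>0\<close> otherwise, and let \<open>\<mu>\<close> be \<open>1 / (n + 1)!\<close> times the sum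
  of all \<open>f (e\<^sub>0, \<dots>, e\<^sub>n) dual e\<^sub>n \<cdots> dual e\<^sub>0\<close>. Bracketing with \<open>a\<close> inserts \<open>a\<close> into the last
  argument of the form, so \<open>[a\<^sub>1, [\<dots>, [a\<^sub>n, \<mu>] \<dots>]]\<close> is the sum of all
  \<open>(e, {a\<^sub>1, \<dots>, a\<^sub>n}) dual e\<close>, which is \<open>{a\<^sub>1, \<dots>, a\<^sub>n}\<close>.\<close>


section \<open>The quotient algebra\<close>

lemma ring_of_type_algebra_simps [simp]:
  "carrier ring_of_type_algebra = UNIV"
  "x \<otimes>\<^bsub>ring_of_type_algebra\<^esub> y = x * y"
  "x \<oplus>\<^bsub>ring_of_type_algebra\<^esub> y = x + y"
  "\<one>\<^bsub>ring_of_type_algebra\<^esub> = 1"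
  "\<zero>\<^bsub>ring_of_type_algebra\<^esub> = 0"
  by (simp_all add: ring_of_type_algebra_def)

lemma ring_ring_of_type_algebra: "ring (ring_of_type_algebra :: 'a::ring_1 ring)"
proof (intro ringI abelian_groupI monoidI)
  show "\<exists>y\<in>carrier ring_of_type_algebra.
      y \<oplus>\<^bsub>ring_of_type_algebra\<^esub> x = \<zero>\<^bsub>ring_of_type_algebra\<^esub>" for x :: 'a
    by (rule bexI[of _ "- x"]) simp_all
qed (simp_all add: algebra_simps)

lemma ideal_super_ideal: "ideal (super_ideal scale V) ring_of_type_algebra"
  unfolding super_ideal_def
  by (rule ring.genideal_ideal[OF ring_ring_of_type_algebra]) simp

lemma super_relations_subset: "super_relations scale V \<subseteq> super_ideal scale V"
  unfolding super_ideal_def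
  by (rule ring.genideal_self[OF ring_ring_of_type_algebra]) simp

lemma sym_class_in_carrier [simp]: "sym_class scale V t \<in> carrier (sym_alg scale V)"
  by (auto simp: sym_class_def sym_alg_def FactRing_def A_RCOSETS_def')

lemma sym_alg_carrierE:
  assumes "u \<in> carrier (sym_alg scale V)"
  obtains t where "u = sym_class scale V t"
  using assms by (auto simp: sym_class_def sym_alg_def FactRing_def A_RCOSETS_def')

lemma sym_class_add:
  "sym_class scale V (s + t) = sym_class scale V s \<oplus>\<^bsub>sym_alg scale V\<^esub> sym_class scale V t"
proof -
  interpret ideal "super_ideal scale V" ring_of_type_algebra
    by (rule ideal_super_ideal)
  show ?thesis
    using a_rcos_sum[of s t] by (simp add: sym_class_def sym_alg_def FactRing_def)
qed

lemma sym_class_mult: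
  "sym_class scale V (s * t) = sym_class scale V s \<otimes>\<^bsub>sym_alg scale V\<^esub> sym_class scale V t"
proof -
  interpret ideal "super_ideal scale V" ring_of_type_algebra
    by (rule ideal_super_ideal)
  show ?thesis
    using rcoset_mult_add[of s t] by (simp add: sym_class_def sym_alg_def FactRing_def)
qed

lemma sym_class_zero: "sym_class scale V 0 = \<zero>\<^bsub>sym_alg scale V\<^esub>"
proof -
  interpret ideal "super_ideal scale V" ring_of_type_algebra
    by (rule ideal_super_ideal)
  show ?thesis
    using a_rcos_zero[OF is_ideal, of 0] additive_subgroup.zero_closed[OF is_additive_subgroup]
    by (simp add: sym_class_def sym_alg_def FactRing_def)
qed

text \<open>Brackets are computed on representatives in the free algebra. These congruences allow a
  representative to be exchanged for another one of the same class inside a sum or product.\<close>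

lemma sym_class_add_cong:
  "sym_class scale V s = sym_class scale V s' \<Longrightarrow> sym_class scale V t = sym_class scale V t' \<Longrightarrow>
    sym_class scale V (s + t) = sym_class scale V (s' + t')"
  by (simp add: sym_class_add)

lemma sym_class_mult_cong:
  "sym_class scale V s = sym_class scale V s' \<Longrightarrow> sym_class scale V t = sym_class scale V t' \<Longrightarrow>
    sym_class scale V (s * t) = sym_class scale V (s' * t')"
  by (simp add: sym_class_mult)

lemma sym_class_sum_cong:
  assumes "\<And>i. i \<in> I \<Longrightarrow> sym_class scale V (s i) = sym_class scale V (t i)"
  shows "sym_class scale V (sum s I) = sym_class scale V (sum t I)"
  using assms by (induction I rule: infinite_finite_induct) (auto simp: sym_class_add)

lemma sym_class_eqI:
  assumes "s - t \<in> super_ideal scale V"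
  shows "sym_class scale V s = sym_class scale V t"
proof -
  interpret ideal "super_ideal scale V" ring_of_type_algebra
    by (rule ideal_super_ideal)
  have "sym_class scale V (s - t) = sym_class scale V 0"
    using a_rcos_zero[OF is_ideal assms] a_rcos_zero[OF is_ideal, of 0]
      additive_subgroup.zero_closed[OF is_additive_subgroup]
    by (simp add: sym_class_def)
  from sym_class_add_cong[OF this refl, of t] show ?thesis by simp
qed

lemma sym_class_gen_add:
  "sym_class scale V (gen (a + b)) = sym_class scale V (gen a + gen b)"
  by (rule sym_class_eqI, rule subsetD[OF super_relations_subset])
     (auto simp: super_relations_def diff_diff_eq)

lemma sym_class_gen_scale:
  "sym_class scale V (gen (scale c a)) = sym_class scale V (const c * gen a)"
  by (rule sym_class_eqI, rule subsetD[OF super_relations_subset])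
     (auto simp: super_relations_def)

text \<open>In the free algebra \<open>gen 0\<close> is a generator and not zero; it vanishes only
  modulo the additivity relation for \<open>0 + 0\<close>.\<close>

lemma sym_class_gen_zero: "sym_class scale V (gen 0) = sym_class scale V 0"
proof -
  have "sym_class scale V (gen 0 + - gen 0) = sym_class scale V ((gen 0 + gen 0) + - gen 0)"
    by (rule sym_class_add_cong[OF _ refl]) (use sym_class_gen_add[of scale V 0 0] in simp)
  thus ?thesis by simp
qed

lemma sym_class_gen_sum:
  assumes "finite I"
  shows "sym_class scale V (gen (sum x I)) = sym_class scale V (\<Sum>i\<in>I. gen (x i))"
  using assms
  by (induction I rule: finite_induct)
     (simp_all add: sym_class_gen_zero sym_class_gen_add sym_class_add)


section \<open>Constants and keys in the free algebra\<close>

lemma const_0 [simp]: "const 0 = 0"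
  and const_1 [simp]: "const 1 = 1"
  by (simp_all add: const_def)

lemma const_add: "const (c + d) = const c + const d"
  by (simp add: const_def single_add)

lemma const_mult: "const (c * d) = const c * const d"
  by (simp add: const_def mult_single)

lemma poly_mapping_sum_monomials:
  "t = (\<Sum>w\<in>Poly_Mapping.keys t. Poly_Mapping.single w (Poly_Mapping.lookup t w))"
  by (rule poly_mapping_eqI) (auto simp: lookup_sum lookup_single when_def in_keys_iff)

lemma const_mult_commute: "const c * t = t * (const c :: ('v, 'k::field) free_alg)"
proof -
  have "const c * (\<Sum>w\<in>K. Poly_Mapping.single w (d w)) =
      (\<Sum>w\<in>K. Poly_Mapping.single w (d w)) * (const c :: ('v, 'k) free_alg)" for K d
    by (simp add: sum_distrib_left sum_distrib_right const_def mult_single mult.commute)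
  thus ?thesis by (metis poly_mapping_sum_monomials)
qed

lemma const_mult_left_commute:
  "t * (const c * s) = const c * (t * (s :: ('v, 'k::field) free_alg))"
  by (metis const_mult_commute mult.assoc)

lemma keys_const_mult:
  assumes "w \<in> Poly_Mapping.keys (const c * t)"
  shows "w \<in> Poly_Mapping.keys t"
  using subsetD[OF keys_mult assms] by (auto simp: const_def split: if_splits)

lemma keys_gen_mult:
  assumes "w \<in> Poly_Mapping.keys (gen a * t)"
  obtains u where "u \<in> Poly_Mapping.keys t" "w = Word (a # letters u)"
  using subsetD[OF keys_mult assms] by (auto simp: gen_def plus_word_def split: if_splits)

lemma parity_sign_square [simp]: "parity_sign p * parity_sign p = (1 :: 'k::ring_1)"
  by (simp add: parity_sign_def)

lemma has_parity_exists:
  assumes "set (letters w) \<subseteq> homogeneous V"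
  shows "\<exists>p. has_parity V p w"
proof -
  have "\<exists>ps. list_all2 (\<lambda>a q. a \<in> V q) as ps" if "set as \<subseteq> homogeneous V" for as
    using that
  proof (induction as)
    case (Cons a as)
    then obtain ps where "list_all2 (\<lambda>a q. a \<in> V q) as ps" by auto
    moreover obtain q where "a \<in> V q" using Cons.prems by (auto simp: homogeneous_def)
    ultimately have "list_all2 (\<lambda>a q. a \<in> V q) (a # as) (q # ps)" by simp
    thus ?case by blast
  qed (intro exI[of _ "[]"], simp)
  thus ?thesis using assms by (auto simp: has_parity_def)
qed

text \<open>The Leibniz rule is available only for elements of a fixed parity, so representatives
  have to be split by the parity of their words.\<close>

lemma homogeneous_parts:
  fixes t :: "('v, 'k::field) free_alg"
  assumes "\<And>w. w \<in> Poly_Mapping.keys t \<Longrightarrow> set (letters w) \<subseteq> homogeneous V"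
  obtains t0 t1 where "t = t0 + t1"
    "\<And>w. w \<in> Poly_Mapping.keys t0 \<Longrightarrow> has_parity V 0 w"
    "\<And>w. w \<in> Poly_Mapping.keys t1 \<Longrightarrow> has_parity V 1 w"
proof
  let ?K = "Poly_Mapping.keys t"
  \<comment> \<open>A word with the letter 0 has both parities. Such words are counted as even, and
    the odd part is the complement of \<open>?A\<close>, so that no monomial is taken twice.\<close>
  let ?A = "{w \<in> ?K. has_parity V 0 w}"
  let ?m = "\<lambda>w. Poly_Mapping.single w (Poly_Mapping.lookup t w)"
  have "t = (\<Sum>w\<in>?K. ?m w)"
    by (rule poly_mapping_sum_monomials)
  also have "\<dots> = sum ?m ?A + sum ?m (?K - ?A)"
    by (subst sum.subset_diff[of ?A ?K]) (auto simp: add.commute)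
  finally show "t = sum ?m ?A + sum ?m (?K - ?A)" .
  have keys: "w \<in> S" if "w \<in> Poly_Mapping.keys (sum ?m S)" for w S
    using subsetD[OF keys_sum that] by (auto split: if_splits)
  show "has_parity V 0 w" if "w \<in> Poly_Mapping.keys (sum ?m ?A)" for w
    using keys[OF that] by simp
  show "has_parity V 1 w" if "w \<in> Poly_Mapping.keys (sum ?m (?K - ?A))" for w
  proof -
    have "w \<in> ?K" "\<not> has_parity V 0 w" using keys[OF that] by auto
    moreover obtain p where "has_parity V p w"
      using has_parity_exists[OF assms[OF \<open>w \<in> ?K\<close>]] by blast
    ultimately show ?thesis by (cases p) auto
  qed
qed


lemmas linear_map_add = module_hom.add[OF Vector_Spaces.linear.axioms(3)]
  and linear_map_scale = module_hom.scale[OF Vector_Spaces.linear.axioms(3)]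
  and linear_map_sum = module_hom.sum[OF Vector_Spaces.linear.axioms(3)]
  and linear_map_diff = module_hom.diff[OF Vector_Spaces.linear.axioms(3)]
  and linear_map_zero = module_hom.zero[OF Vector_Spaces.linear.axioms(3)]


section \<open>Multilinear and supersymmetric forms\<close>

definition multilinear_form ::
  "('k::field \<Rightarrow> 'v::ab_group_add \<Rightarrow> 'v) \<Rightarrow> nat \<Rightarrow> ('v list \<Rightarrow> 'k) \<Rightarrow> bool" where
  "multilinear_form scale n f \<longleftrightarrow>
     (\<forall>xs ys. length xs + 1 + length ys = n \<longrightarrow>
        Vector_Spaces.linear scale (*) (\<lambda>a. f (xs @ a # ys)))"

definition supersymmetric_form ::
  "(bit \<Rightarrow> 'v set) \<Rightarrow> nat \<Rightarrow> ('v list \<Rightarrow> 'k::field) \<Rightarrow> bool" where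
  "supersymmetric_form V n f \<longleftrightarrow>
     (\<forall>p q. \<forall>a\<in>V p. \<forall>b\<in>V q. \<forall>xs ys.
        set xs \<subseteq> homogeneous V \<longrightarrow> set ys \<subseteq> homogeneous V \<longrightarrow>
        length xs + 2 + length ys = n \<longrightarrow>
        f (xs @ a # b # ys) = parity_sign (p * q) * f (xs @ b # a # ys))"

lemma supersymmetric_formD:
  assumes "supersymmetric_form V n f" "a \<in> V p" "b \<in> V q"
    and "set xs \<subseteq> homogeneous V" "set ys \<subseteq> homogeneous V" "length xs + 2 + length ys = n"
  shows "f (xs @ a # b # ys) = parity_sign (p * q) * f (xs @ b # a # ys)"
  using assms unfolding supersymmetric_form_def by blast

lemma multilinear_form_snoc:
  "multilinear_form scale (Suc n) f \<Longrightarrow> multilinear_form scale n (\<lambda>xs. f (xs @ [a]))"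
  unfolding multilinear_form_def by auto

lemma multilinear_form_last:
  "multilinear_form scale (Suc n) f \<Longrightarrow> length xs = n \<Longrightarrow>
    Vector_Spaces.linear scale (*) (\<lambda>a. f (xs @ [a]))"
  unfolding multilinear_form_def by auto

context super_vector_space
begin

lemma parity_split:
  obtains a0 a1 where "a0 \<in> V 0" "a1 \<in> V 1" "x = a0 + a1"
  using components_sum[of x] by blast

text \<open>The fixed last argument \<open>a\<close> may be inhomogeneous, where supersymmetry says
  nothing. By linearity it suffices to treat its even and odd parts.\<close>

lemma supersymmetric_form_snoc:
  assumes "multilinear_form scale (Suc n) f" "supersymmetric_form V (Suc n) f"
  shows "supersymmetric_form V n (\<lambda>xs. f (xs @ [a]))"
proof -
  obtain a0 a1 where a: "a0 \<in> V 0" "a1 \<in> V 1" "a = a0 + a1"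
    by (rule parity_split)
  have split: "f (xs @ [a]) = f (xs @ [a0]) + f (xs @ [a1])" if "length xs = n" for xs
    unfolding a(3) by (rule linear_map_add[OF multilinear_form_last[OF assms(1) that]])
  show ?thesis
    unfolding supersymmetric_form_def
  proof (intro allI ballI impI)
    fix p q x y xs ys
    assume *: "x \<in> V p" "y \<in> V q" "set xs \<subseteq> homogeneous V" "set ys \<subseteq> homogeneous V"
      "length xs + 2 + length ys = n"
    have "f ((xs @ x # y # ys) @ [b]) = parity_sign (p * q) * f ((xs @ y # x # ys) @ [b])"
      if "b \<in> homogeneous V" for b
      using supersymmetric_formD[OF assms(2) *(1,2,3), of "ys @ [b]"] *(4,5) that by simp
    from this[of a0] this[of a1] a(1,2) *(5)
    show "f ((xs @ x # y # ys) @ [a]) = parity_sign (p * q) * f ((xs @ y # x # ys) @ [a])"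
      by (subst (1 2) split) (auto simp: homogeneous_def algebra_simps)
  qed
qed

end


section \<open>Symmetrization of a form along a pair of dual bases\<close>

text \<open>Duality enters through the two expansions: \<open>expand\<close> serves to compute
  brackets, \<open>expand_dual\<close> to recover a vector from its pairings with
  \<open>E\<close>.\<close>

locale super_dual_bases = super_vector_space scale V
  for scale :: "'k::field \<Rightarrow> 'v::ab_group_add \<Rightarrow> 'v" and V :: "bit \<Rightarrow> 'v set" +
  fixes B :: "'v \<Rightarrow> 'v \<Rightarrow> 'k"
    and E :: "'v set"
    and dual :: "'v \<Rightarrow> 'v"
  assumes finite_E: "finite E"
    and homogeneous_pair: "e \<in> E \<Longrightarrow> \<exists>p. e \<in> V p \<and> dual e \<in> V p"
    and expand: "a = (\<Sum>e\<in>E. scale (B a (dual e)) e)"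
    and expand_dual: "a = (\<Sum>e\<in>E. scale (B e a) (dual e))"
begin

text \<open>Unfolded, this is \<open>1 / n!\<close> times the sum of all
  \<open>f [e\<^sub>1, ..., e\<^sub>n]\<close> times
  \<open>dual e\<^sub>n ... dual e\<^sub>1\<close>. The last argument of \<open>f\<close> is split
  off first because the innermost bracket fills that place.\<close>

fun symmetrize :: "nat \<Rightarrow> ('v list \<Rightarrow> 'k) \<Rightarrow> ('v, 'k) free_alg" where
  "symmetrize 0 f = const (f [])"
| "symmetrize (Suc n) f =
     const (1 / of_nat (Suc n)) * (\<Sum>e\<in>E. gen (dual e) * symmetrize n (\<lambda>xs. f (xs @ [e])))"

text \<open>Only basis vectors are inserted into the form, and these are homogeneous. Hence
  supersymmetry, which is known for homogeneous arguments only, can be used under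
  \<open>symmetrize\<close>.\<close>

lemma symmetrize_cong:
  assumes "\<And>xs. length xs = n \<Longrightarrow> set xs \<subseteq> homogeneous V \<Longrightarrow> f xs = g xs"
  shows "symmetrize n f = symmetrize n g"
  using assms
proof (induction n arbitrary: f g)
  case (Suc n)
  have "symmetrize n (\<lambda>xs. f (xs @ [e])) = symmetrize n (\<lambda>xs. g (xs @ [e]))" if "e \<in> E" for e
  proof (rule Suc.IH)
    fix xs assume "length xs = n" "set xs \<subseteq> homogeneous V"
    moreover obtain p where "e \<in> V p" using homogeneous_pair[OF \<open>e \<in> E\<close>] by blast
    hence "e \<in> homogeneous V" by (cases p) (auto simp: homogeneous_def)
    ultimately show "f (xs @ [e]) = g (xs @ [e])" by (intro Suc.prems) auto
  qed
  thus ?case by simp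
qed simp

lemma symmetrize_add:
  "symmetrize n (\<lambda>xs. f xs + g xs) = symmetrize n f + symmetrize n g"
  by (induction n arbitrary: f g) (simp_all add: const_add algebra_simps sum.distrib)

lemma symmetrize_scale:
  "symmetrize n (\<lambda>xs. c * f xs) = const c * symmetrize n f"
proof (induction n arbitrary: f)
  case (Suc n)
  have "(\<Sum>e\<in>E. gen (dual e) * symmetrize n (\<lambda>xs. c * f (xs @ [e]))) =
      const c * (\<Sum>e\<in>E. gen (dual e) * symmetrize n (\<lambda>xs. f (xs @ [e])))"
    unfolding Suc.IH sum_distrib_left by (rule sum.cong[OF refl const_mult_left_commute])
  thus ?case
    by (simp only: symmetrize.simps const_mult_left_commute[of "const _"])
qed (simp add: const_mult)

lemma symmetrize_sum:
  assumes "finite I"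
  shows "symmetrize n (\<lambda>xs. \<Sum>i\<in>I. f i xs) = (\<Sum>i\<in>I. symmetrize n (f i))"
  using assms
proof (induction I rule: finite_induct)
  case empty
  show ?case using symmetrize_scale[of n 0 "\<lambda>_. 0"] by simp
qed (simp add: symmetrize_add)

text \<open>The length places the class in a symmetric power; the homogeneity of the letters is what
  splitting by parity requires.\<close>

lemma keys_symmetrize:
  assumes "w \<in> Poly_Mapping.keys (symmetrize n f)"
  shows "length (letters w) = n" "set (letters w) \<subseteq> homogeneous V"
proof -
  have "length (letters w) = n \<and> set (letters w) \<subseteq> homogeneous V"
    using assms
  proof (induction n arbitrary: f w)
    case 0
    then show ?case by (auto simp: const_def zero_word_def split: if_splits)
  next
    case (Suc n)
    from keys_const_mult[OF Suc.prems[unfolded symmetrize.simps]]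
    obtain e where e: "e \<in> E"
      and w: "w \<in> Poly_Mapping.keys (gen (dual e) * symmetrize n (\<lambda>xs. f (xs @ [e])))"
      using keys_sum by fast
    from w obtain u where u: "u \<in> Poly_Mapping.keys (symmetrize n (\<lambda>xs. f (xs @ [e])))"
      "w = Word (dual e # letters u)"
      by (rule keys_gen_mult)
    obtain p where "dual e \<in> V p" using homogeneous_pair[OF e] by blast
    hence "dual e \<in> homogeneous V" by (cases p) (auto simp: homogeneous_def)
    with Suc.IH[OF u(1)] u(2) show ?case by simp
  qed
  thus "length (letters w) = n" "set (letters w) \<subseteq> homogeneous V" by auto
qed

end


section \<open>Bracketing with a vector\<close>

locale super_dual_bases_bracket = super_dual_bases scale V B E dual
  for scale :: "'k::field \<Rightarrow> 'v::ab_group_add \<Rightarrow> 'v" and V B E dual +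
  fixes br
  assumes poisson: "poisson_bracket scale V B br"
begin

abbreviation "cls \<equiv> sym_class scale V"

lemma bracket_add_right:
  "br (cls u) (cls (s + t)) = br (cls u) (cls s) \<oplus>\<^bsub>sym_alg scale V\<^esub> br (cls u) (cls t)"
  by (simp add: sym_class_add poisson_bracket.br_add_right[OF poisson])

lemma bracket_add_left:
  "br (cls (s + t)) (cls u) = br (cls s) (cls u) \<oplus>\<^bsub>sym_alg scale V\<^esub> br (cls t) (cls u)"
  by (simp add: sym_class_add poisson_bracket.br_add_left[OF poisson])

lemma bracket_const_mult:
  assumes "br (cls u) (cls s) = cls t"
  shows "br (cls u) (cls (const c * s)) = cls (const c * t)"
  using poisson_bracket.br_scale_right[OF poisson, of "cls u" "cls s" c] assms
  by (simp add: sym_class_mult sym_scalar_def)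

lemma bracket_const: "br (cls u) (cls (const c)) = cls 0"
  using poisson_bracket.br_scalar_right[OF poisson, of "cls u" c]
  by (simp add: sym_class_zero sym_scalar_def)

lemma bracket_sum:
  assumes "finite I" "\<And>i. i \<in> I \<Longrightarrow> br (cls u) (cls (s i)) = cls (t i)"
  shows "br (cls u) (cls (sum s I)) = cls (sum t I)"
  using assms
proof (induction I rule: finite_induct)
  case empty
  show ?case using bracket_const[of u 0] by simp
next
  case (insert i I)
  show ?case
    using insert.prems[of i] insert.IH insert.prems insert.hyps
    by (simp add: bracket_add_right) (simp add: sym_class_add)
qed

text \<open>The sign in the Leibniz rule depends on the parities of \<open>a\<close> and
  \<open>b\<close> alone. It is therefore the same for the even and the odd part of
  \<open>s\<close>, and the rule extends to their sum.\<close>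

lemma bracket_gen_mult:
  assumes a: "a \<in> V p" and b: "b \<in> V q"
    and s: "\<And>w. w \<in> Poly_Mapping.keys s \<Longrightarrow> set (letters w) \<subseteq> homogeneous V"
    and t: "br (cls (gen a)) (cls s) = cls t"
  shows "br (cls (gen a)) (cls (gen b * s)) =
    cls (const (B a b) * s + const (parity_sign (p * q)) * gen b * t)"
proof -
  have gen_component: "cls (gen x) \<in> sym_component scale V r" if "x \<in> V r" for x r
  proof -
    have "has_parity V r (Word [x])"
      unfolding has_parity_def using that by (intro exI[of _ "[r]"]) simp
    thus ?thesis unfolding sym_component_def by (auto simp: gen_def)
  qed
  have leibniz: "br (cls (gen a)) (cls (gen b * s')) =
      cls (const (B a b) * s' + const (parity_sign (p * q)) * gen b * t')"
    if "\<And>w. w \<in> Poly_Mapping.keys s' \<Longrightarrow> has_parity V r w"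
      and t': "br (cls (gen a)) (cls s') = cls t'" for s' t' r
  proof -
    have "cls s' \<in> sym_component scale V r"
      unfolding sym_component_def using that(1) by auto
    from poisson_bracket.br_leibniz[OF poisson gen_component[OF a] gen_component[OF b] this]
    show ?thesis
      using poisson_bracket.br_incl[OF poisson, of a b] t'
      by (simp add: sym_class_mult sym_class_add sym_scalar_def sym_incl_def)
  qed
  obtain s0 s1 where s01: "s = s0 + s1"
    "\<And>w. w \<in> Poly_Mapping.keys s0 \<Longrightarrow> has_parity V 0 w"
    "\<And>w. w \<in> Poly_Mapping.keys s1 \<Longrightarrow> has_parity V 1 w"
    using homogeneous_parts[of s V] s by metis
  obtain t0 t1 where t01: "br (cls (gen a)) (cls s0) = cls t0" "br (cls (gen a)) (cls s1) = cls t1"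
    using poisson_bracket.br_closed[OF poisson] by (metis sym_alg_carrierE sym_class_in_carrier)
  \<comment> \<open>The representative \<open>t\<close> is arbitrary, so it agrees with
    \<open>t0 + t1\<close> only as a class.\<close>
  have "cls t = cls (t0 + t1)"
    by (subst sym_class_add) (simp only: t[symmetric] s01(1) bracket_add_right t01)
  hence "cls (const (B a b) * s + const (parity_sign (p * q)) * gen b * t) =
      cls (const (B a b) * s + const (parity_sign (p * q)) * gen b * (t0 + t1))"
    by (intro sym_class_add_cong sym_class_mult_cong refl)
  also have "\<dots> = cls ((const (B a b) * s0 + const (parity_sign (p * q)) * gen b * t0) +
      (const (B a b) * s1 + const (parity_sign (p * q)) * gen b * t1))"
    by (simp add: s01(1) algebra_simps)
  also have "\<dots> = br (cls (gen a)) (cls (gen b * s))"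
    by (subst sym_class_add) (simp only: s01(1) distrib_left bracket_add_right
        leibniz[OF s01(2) t01(1)] leibniz[OF s01(3) t01(2)])
  finally show ?thesis ..
qed

end

text \<open>In \<open>[a, dual e \<cdot> w]\<close> the terms \<open>[a, dual e] w\<close> add up to one copy of the right-hand side;
  by the induction hypothesis and supersymmetry the terms \<open>\<plusminus> dual e [a, w]\<close> add up to \<open>n\<close>
  further copies. This is what the factors \<open>1 / of_nat (Suc n)\<close> in \<open>symmetrize\<close> cancel.\<close>

lemma (in super_dual_bases_bracket) bracket_symmetrize:
  assumes char_0: "\<And>k. of_nat (Suc k) \<noteq> (0 :: 'k)"
    and "multilinear_form scale (Suc n) f" "supersymmetric_form V (Suc n) f"
  shows "br (cls (gen a)) (cls (symmetrize (Suc n) f)) = cls (symmetrize n (\<lambda>xs. f (xs @ [a])))"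
  using assms(2,3)
proof (induction n arbitrary: f a rule: less_induct)
  case (less n)
  have homogeneous_case: "br (cls (gen a)) (cls (symmetrize (Suc n) f)) =
      cls (symmetrize n (\<lambda>xs. f (xs @ [a])))" if a: "a \<in> V p" for a p
  proof -
    define g where "g = (\<lambda>xs. f (xs @ [a]))"
    \<comment> \<open>Up to sign \<open>T e\<close> represents the bracket of \<open>a\<close> with
      the coefficient of \<open>dual e\<close>. For \<open>n = 0\<close> that coefficient is a
      scalar, whose bracket is 0.\<close>
    define T where "T e = (if n = 0 then 0 else symmetrize (n - 1) (\<lambda>xs. g (xs @ [e])))" for e
    have inner: "br (cls (gen a)) (cls (symmetrize n (\<lambda>xs. f (xs @ [e])))) =
        cls (const (parity_sign (p * q)) * T e)" if e: "e \<in> V q" for e q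
    proof (cases n)
      case 0
      thus ?thesis using bracket_const by (simp add: T_def)
    next
      case (Suc k)
      \<comment> \<open>The induction hypothesis puts \<open>a\<close> in front of \<open>e\<close>;
        supersymmetry then moves \<open>a\<close> to the last place, at the cost of a sign.\<close>
      have "br (cls (gen a)) (cls (symmetrize (Suc k) (\<lambda>xs. f (xs @ [e])))) =
          cls (symmetrize k (\<lambda>xs. f ((xs @ [a]) @ [e])))"
        using less.prems unfolding Suc
        by (intro less.IH multilinear_form_snoc supersymmetric_form_snoc) (auto simp: Suc)
      also have "symmetrize k (\<lambda>xs. f ((xs @ [a]) @ [e])) =
          symmetrize k (\<lambda>xs. parity_sign (p * q) * g (xs @ [e]))"
      proof (rule symmetrize_cong)
        fix xs :: "'v list" assume xs: "length xs = k" "set xs \<subseteq> homogeneous V"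
        have "f (xs @ a # e # []) = parity_sign (p * q) * f (xs @ e # a # [])"
          by (rule supersymmetric_formD[OF less.prems(2) a e xs(2)]) (simp_all add: xs(1) Suc)
        thus "f ((xs @ [a]) @ [e]) = parity_sign (p * q) * g (xs @ [e])"
          by (simp add: g_def)
      qed
      finally show ?thesis using Suc by (simp add: symmetrize_scale T_def)
    qed
    have outer: "br (cls (gen a)) (cls (gen (dual e) * symmetrize n (\<lambda>xs. f (xs @ [e])))) =
        cls (const (B a (dual e)) * symmetrize n (\<lambda>xs. f (xs @ [e])) + gen (dual e) * T e)"
      if "e \<in> E" for e
    proof -
      obtain q where q: "e \<in> V q" "dual e \<in> V q" using homogeneous_pair[OF \<open>e \<in> E\<close>] by blast
      \<comment> \<open>One sign comes from the Leibniz rule for \<open>dual e\<close>, the other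
        from exchanging \<open>a\<close> and \<open>e\<close>. They cancel because \<open>e\<close>
        and \<open>dual e\<close> have the same parity.\<close>
      have "const (parity_sign (p * q)) * gen (dual e) * (const (parity_sign (p * q)) * T e) =
          (const (parity_sign (p * q) * parity_sign (p * q)) * gen (dual e) * T e)"
        by (simp only: const_mult mult.assoc const_mult_left_commute[of "gen _"])
      hence sign: "const (parity_sign (p * q)) * gen (dual e) * (const (parity_sign (p * q)) * T e) =
          gen (dual e) * T e" by simp
      show ?thesis
        using bracket_gen_mult[OF a q(2) keys_symmetrize(2) inner[OF q(1)]] unfolding sign .
    qed
    have g_expand: "symmetrize n g = (\<Sum>e\<in>E. const (B a (dual e)) * symmetrize n (\<lambda>xs. f (xs @ [e])))"
    proof -
      have "symmetrize n g = symmetrize n (\<lambda>xs. \<Sum>e\<in>E. B a (dual e) * f (xs @ [e]))"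
      proof (rule symmetrize_cong)
        fix xs :: "'v list" assume "length xs = n"
        from multilinear_form_last[OF less.prems(1) this]
        interpret lin: Vector_Spaces.linear scale "(*)" "\<lambda>a. f (xs @ [a])" .
        show "g xs = (\<Sum>e\<in>E. B a (dual e) * f (xs @ [e]))"
          unfolding g_def by (subst expand[of a]) (simp add: lin.sum lin.scale)
      qed
      thus ?thesis by (simp add: symmetrize_sum[OF finite_E] symmetrize_scale)
    qed
    \<comment> \<open>The left-hand side is the sum in the recursion for
      \<open>symmetrize n g\<close> without its factor \<open>1 / n\<close>. For
      \<open>n = 0\<close> both sides are 0.\<close>
    have T_sum: "(\<Sum>e\<in>E. gen (dual e) * T e) = const (of_nat n) * symmetrize n g"
    proof (cases n)
      case (Suc k)
      have "T e = symmetrize k (\<lambda>xs. g (xs @ [e]))" for e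
        by (simp add: T_def Suc)
      hence "const (of_nat n) * symmetrize n g =
          const (of_nat n * (1 / of_nat n)) * (\<Sum>e\<in>E. gen (dual e) * T e)"
        by (simp only: Suc symmetrize.simps const_mult mult.assoc)
      moreover have "of_nat n * (1 / of_nat n) = (1 :: 'k)"
        using char_0[of k] Suc by (simp del: of_nat_Suc)
      ultimately show ?thesis by simp
    qed (simp add: T_def)
    have "br (cls (gen a)) (cls (\<Sum>e\<in>E. gen (dual e) * symmetrize n (\<lambda>xs. f (xs @ [e])))) =
        cls (\<Sum>e\<in>E. const (B a (dual e)) * symmetrize n (\<lambda>xs. f (xs @ [e])) + gen (dual e) * T e)"
      by (rule bracket_sum[OF finite_E outer])
    also have "(\<Sum>e\<in>E. const (B a (dual e)) * symmetrize n (\<lambda>xs. f (xs @ [e])) + gen (dual e) * T e) =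
        const (of_nat (Suc n)) * symmetrize n g"
      by (simp add: sum.distrib T_sum const_add distrib_right flip: g_expand)
    finally have "br (cls (gen a)) (cls (symmetrize (Suc n) f)) =
        cls (const (1 / of_nat (Suc n)) * (const (of_nat (Suc n)) * symmetrize n g))"
      unfolding symmetrize.simps by (rule bracket_const_mult)
    also have "const (1 / of_nat (Suc n)) * (const (of_nat (Suc n)) * symmetrize n g) = symmetrize n g"
      using char_0[of n] by (simp add: const_mult[symmetric] mult.assoc[symmetric] del: of_nat_Suc)
    finally show ?thesis unfolding g_def .
  qed
  obtain a0 a1 where a: "a0 \<in> V 0" "a1 \<in> V 1" "a = a0 + a1"
    by (rule parity_split)
  have "br (cls (gen a)) (cls (symmetrize (Suc n) f)) =
      br (cls (gen a0 + gen a1)) (cls (symmetrize (Suc n) f))"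
    by (simp only: a(3) sym_class_gen_add)
  also have "\<dots> = cls (symmetrize n (\<lambda>xs. f (xs @ [a0])) + symmetrize n (\<lambda>xs. f (xs @ [a1])))"
    by (simp only: bracket_add_left homogeneous_case[OF a(1)] homogeneous_case[OF a(2)])
       (simp only: sym_class_add)
  also have "symmetrize n (\<lambda>xs. f (xs @ [a0])) + symmetrize n (\<lambda>xs. f (xs @ [a1])) =
      symmetrize n (\<lambda>xs. f (xs @ [a]))"
    unfolding symmetrize_add[symmetric]
    by (rule symmetrize_cong) (simp add: a(3) linear_map_add[OF multilinear_form_last[OF less.prems(1)]])
  finally show ?case .
qed

text \<open>Induction runs from the right end of \<open>as\<close>, since the innermost bracket is
  taken with the last vector.\<close>

lemma (in super_dual_bases_bracket) iterated_bracket_symmetrize: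
  assumes char_0: "\<And>k. of_nat (Suc k) \<noteq> (0 :: 'k)"
    and "multilinear_form scale (n + length as) f" "supersymmetric_form V (n + length as) f"
  shows "foldr (\<lambda>a s. br (cls (gen a)) s) as (cls (symmetrize (n + length as) f)) =
    cls (symmetrize n (\<lambda>xs. f (xs @ as)))"
  using assms(2,3)
proof (induction as arbitrary: f rule: rev_induct)
  case (snoc a as)
  have "multilinear_form scale (n + length as) (\<lambda>xs. f (xs @ [a]))"
    using snoc.prems by (intro multilinear_form_snoc) simp
  moreover have "supersymmetric_form V (n + length as) (\<lambda>xs. f (xs @ [a]))"
    using snoc.prems by (intro supersymmetric_form_snoc) simp_all
  ultimately show ?case
    using snoc.IH[of "\<lambda>xs. f (xs @ [a])"] bracket_symmetrize[OF char_0, of "n + length as" f a] snoc.prems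
    by (simp del: symmetrize.simps)
qed simp


section \<open>Existence of homogeneous dual bases\<close>

text \<open>The type class provides an isomorphism onto the reals or the complex numbers, along
  which characteristic 0 is pulled back. The image of 1 is a nonzero idempotent, hence 1.\<close>

lemma of_nat_Suc_neq_0_real_or_complex: "of_nat (Suc k) \<noteq> (0 :: 'k::real_or_complex)"
proof -
  have char_0: "of_nat (Suc k) \<noteq> (0 :: 'k)"
    if "bij f" "\<And>x y. f (x + y) = f x + f y \<and> f (x * y) = f x * f y"
    for f :: "'k \<Rightarrow> 'l::field_char_0"
  proof -
    have zero: "f 0 = 0" using that(2)[of 0 0] by simp
    have inj: "f x = f y \<Longrightarrow> x = y" for x y using that(1) by (meson bij_is_inj injD)
    have "f 1 \<noteq> 0" using inj[of 1 0] zero by auto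
    moreover have "f 1 * f 1 = f 1" using that(2)[of 1 1] by simp
    ultimately have one: "f 1 = 1" by simp
    have "f (of_nat k) = of_nat k" for k
      by (induction k) (simp_all add: zero one that(2))
    thus ?thesis using zero by (metis of_nat_neq_0)
  qed
  show ?thesis using real_or_complex[where 'a = 'k] char_0 by metis
qed

text \<open>For a homogeneous basis \<open>E\<close>, let \<open>L y\<close> be the vector with
  coordinates \<open>B e y\<close>. Non-degeneracy makes \<open>L\<close> injective, finite
  dimension makes it bijective, and evenness of the form makes it preserve parity. The dual basis is
  the preimage of \<open>E\<close> under \<open>L\<close>.\<close>

lemma super_dual_bases_exist:
  fixes scale :: "'k::field \<Rightarrow> 'v::ab_group_add \<Rightarrow> 'v"
  assumes super: "super_vector_space scale V"
    and fin: "finite_dimensional_vector_space scale Basis"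
    and bilinear: "bilinear_form scale B"
    and even: "even_form V B"
    and nondeg: "nondegenerate B"
  shows "\<exists>E dual. super_dual_bases scale V B E dual"
proof -
  interpret super_vector_space scale V by (rule super)
  interpret finite_dimensional_vector_space scale Basis by (rule fin)
  have lin1: "Vector_Spaces.linear scale (*) (\<lambda>x. B x y)" for y
    using bilinear by (simp add: bilinear_form_def)
  have lin2: "Vector_Spaces.linear scale (*) (\<lambda>y. B x y)" for x
    using bilinear by (simp add: bilinear_form_def)
  note B_simps = linear_map_add[OF lin1] linear_map_scale[OF lin1] linear_map_sum[OF lin1]
    linear_map_add[OF lin2] linear_map_scale[OF lin2] linear_map_sum[OF lin2]
    linear_map_diff[OF lin1] linear_map_diff[OF lin2]
  obtain E where E: "E \<subseteq> homogeneous V" "independent E" "homogeneous V \<subseteq> span E"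
    by (rule maximal_independent_subset)
  have finite_E: "finite E" by (rule finiteI_independent[OF E(2)])
  have span_E: "x \<in> span E" for x
  proof -
    obtain a b where "a \<in> V 0" "b \<in> V 1" "x = a + b" by (rule parity_split)
    thus ?thesis using E(3) by (auto simp: homogeneous_def intro: span_add)
  qed
  have parity_E: "\<exists>p. e \<in> V p" if "e \<in> E" for e
    using E(1) that by (auto simp: homogeneous_def)
  have eq_onE: "B x y = B x z" if "\<And>e. e \<in> E \<Longrightarrow> B e y = B e z" for x y z
    using span_E[of x]
    by (induction rule: span_induct_alt) (auto simp: B_simps that linear_map_zero[OF lin1])
  have B_inj: "y = z" if "\<And>e. e \<in> E \<Longrightarrow> B e y = B e z" for y z
  proof -
    have "\<forall>x. B x (y - z) = 0" using eq_onE[OF that] by (simp add: B_simps)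
    hence "y - z = 0" using nondeg unfolding nondegenerate_def by blast
    thus ?thesis by simp
  qed
  define L where "L y = (\<Sum>e\<in>E. scale (B e y) e)" for y
  have coeff: "c e = d e"
    if "(\<Sum>e\<in>E. scale (c e) e) = (\<Sum>e\<in>E. scale (d e) e)" "e \<in> E" for c d e
    using independentD[OF E(2) finite_E order_refl, of "\<lambda>e. c e - d e" e] that
    by (simp add: scale_left_diff_distrib sum_subtractf)
  have L_linear: "Vector_Spaces.linear scale scale L"
    by (unfold_locales) (simp_all add: L_def B_simps scale_left_distrib sum.distrib scale_sum_right)
  have L_inj: "inj L"
  proof (rule injI)
    fix y z assume "L y = L z"
    hence "B e y = B e z" if "e \<in> E" for e
      using coeff[of "\<lambda>e. B e y" "\<lambda>e. B e z"] that by (simp add: L_def)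
    thus "y = z" by (rule B_inj)
  qed
  have L_surj: "surj L"
    using linear_inj_imp_surj[OF L_linear L_inj] .
  define dual where "dual = inv_into UNIV L"
  have L_dual: "L (dual e) = e" for e
    unfolding dual_def by (rule surj_f_inv_f[OF L_surj])
  have delta: "B e (dual e') = (if e = e' then 1 else 0)" if "e \<in> E" "e' \<in> E" for e e'
  proof (rule coeff[OF _ that(1)])
    have "(\<Sum>x\<in>E. scale (if x = e' then 1 else 0) x) = (\<Sum>x\<in>E. if x = e' then x else 0)"
      by (rule sum.cong) auto
    thus "(\<Sum>x\<in>E. scale (B x (dual e')) x) = (\<Sum>x\<in>E. scale (if x = e' then 1 else 0) x)"
      using L_dual[of e'] finite_E that(2) by (simp add: L_def)
  qed
  have L_parity: "L y \<in> V p" if "y \<in> V p" for y p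
    unfolding L_def
  proof (rule subspace_sum[OF subspace_component])
    fix e assume "e \<in> E"
    then obtain q where q: "e \<in> V q" using parity_E by blast
    show "scale (B e y) e \<in> V p"
    proof (cases "p = q")
      case True
      thus ?thesis using q by (simp add: subspace_scale[OF subspace_component])
    next
      case False
      hence "B e y = 0" using even q that unfolding even_form_def by metis
      thus ?thesis by (simp add: subspace_0[OF subspace_component])
    qed
  qed
  have dual_parity: "dual e \<in> V p" if "e \<in> V p" for e p
  proof -
    \<comment> \<open>The part \<open>v\<close> of the wrong parity is zero:
      \<open>L v = e - L u\<close> lies in both components, and \<open>L\<close> is
      injective.\<close>
    have *: "dual e \<in> V p" if "e \<in> V p" "u \<in> V p" "v \<in> V q" "dual e = u + v" "p \<noteq> q" for u v q
    proof -
      have "L v = e - L u"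
        using L_dual[of e] that(4) linear_map_add[OF L_linear, of u v] by (simp add: eq_diff_eq add.commute)
      hence "L v \<in> V p"
        using that(1) L_parity[OF that(2)] subspace_diff[OF subspace_component] by simp
      moreover have "L v \<in> V q" by (rule L_parity[OF that(3)])
      ultimately have "L v = 0" using components_Int that(5) by (cases p; cases q) auto
      hence "v = 0" using L_inj linear_map_zero[OF L_linear] by (metis injD)
      thus ?thesis using that by simp
    qed
    obtain u v where "u \<in> V 0" "v \<in> V 1" "dual e = u + v" by (rule parity_split)
    thus ?thesis using *[of u v 1] *[of v u 0] that by (cases p) (auto simp: add.commute)
  qed
  have expand: "a = (\<Sum>e\<in>E. scale (B a (dual e)) e)" for a
    using span_E[of a]
  proof (induction rule: span_induct_alt)
    case base
    show ?case by (simp add: linear_map_zero[OF lin1])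
  next
    case (step c x y)
    have "(\<Sum>e\<in>E. scale (B x (dual e)) e) = (\<Sum>e\<in>E. if x = e then e else 0)"
      using step(1) by (intro sum.cong) (auto simp: delta)
    hence "(\<Sum>e\<in>E. scale (B x (dual e)) e) = x" using finite_E step(1) by simp
    hence "(\<Sum>e\<in>E. scale (c * B x (dual e)) e) = scale c x"
      by (simp flip: scale_scale scale_sum_right)
    thus ?case using step(2) by (simp add: B_simps scale_left_distrib sum.distrib)
  qed
  have "a = (\<Sum>e\<in>E. scale (B e a) (dual e))" for a
  proof (rule B_inj)
    fix e assume "e \<in> E"
    have "B e (\<Sum>e\<in>E. scale (B e a) (dual e)) = (\<Sum>e'\<in>E. if e = e' then B e' a else 0)"
      unfolding B_simps using \<open>e \<in> E\<close> by (intro sum.cong) (auto simp: delta)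
    thus "B e a = B e (\<Sum>e\<in>E. scale (B e a) (dual e))"
      using finite_E \<open>e \<in> E\<close> by simp
  qed
  with finite_E expand dual_parity parity_E have "super_dual_bases scale V B E dual"
    by unfold_locales blast+
  thus ?thesis by blast
qed

section \<open>The form attached to an invariant operation, and the element \<mu>\<close>

theorem proposition1:
  fixes scale :: "'k::real_or_complex \<Rightarrow> 'v::ab_group_add \<Rightarrow> 'v"
    and V :: "bit \<Rightarrow> 'v set"
    and B :: "'v \<Rightarrow> 'v \<Rightarrow> 'k"
    and br :: "('v, 'k) free_alg set \<Rightarrow> ('v, 'k) free_alg set \<Rightarrow> ('v, 'k) free_alg set"
    and n :: nat
    and m :: "'v list \<Rightarrow> 'v"
  assumes "super_vector_space scale V"
    and "\<exists>Basis. finite_dimensional_vector_space scale Basis"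
    and "bilinear_form scale B"
    and "even_form V B"
    and "super_skew_symmetric V B"
    and "nondegenerate B"
    and "poisson_bracket scale V B br"
    and "n \<ge> 1"
    and "n_linear scale n m"
    and "super_commutative scale V n m"
    and "invariant_structure V B n m"
  shows "\<exists>\<mu> \<in> sym_power scale V (n + 1). \<forall>as. length as = n \<longrightarrow>
           sym_incl scale V (m as) = foldr (\<lambda>a s. br (sym_incl scale V a) s) as \<mu>"
proof -
  obtain E dual where "super_dual_bases scale V B E dual"
    using super_dual_bases_exist assms(1-4,6) by blast
  then interpret super_dual_bases_bracket scale V B E dual br
    using assms(7) by (simp add: super_dual_bases_bracket_def super_dual_bases_bracket_axioms_def)
  have lin1: "Vector_Spaces.linear scale (*) (\<lambda>x. B x y)" for y
    using assms(3) by (simp add: bilinear_form_def)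
  have lin2: "Vector_Spaces.linear scale (*) (\<lambda>y. B x y)" for x
    using assms(3) by (simp add: bilinear_form_def)
  define f where "f xs = B (hd xs) (m (tl xs))" for xs
  have f_linear: "multilinear_form scale (1 + n) f"
    unfolding multilinear_form_def
  proof (intro allI impI)
    fix xs ys :: "'v list" assume len: "length xs + 1 + length ys = 1 + n"
    show "Vector_Spaces.linear scale (*) (\<lambda>a. f (xs @ a # ys))"
    proof (cases xs)
      case Nil
      thus ?thesis by (simp add: f_def lin1)
    next
      case (Cons x zs)
      have "Vector_Spaces.linear scale scale (\<lambda>a. m (zs @ a # ys))"
        using assms(9) len Cons by (simp add: n_linear_def)
      from Vector_Spaces.linear_compose[OF this lin2[of x]]
      show ?thesis by (simp add: f_def Cons o_def)
    qed
  qed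
  have f_symmetric: "supersymmetric_form V (1 + n) f"
    unfolding supersymmetric_form_def
  proof (intro allI ballI impI)
    fix p q a b and xs ys :: "'v list"
    assume *: "a \<in> V p" "b \<in> V q" "set xs \<subseteq> homogeneous V" "set ys \<subseteq> homogeneous V"
      and len: "length xs + 2 + length ys = 1 + n"
    show "f (xs @ a # b # ys) = parity_sign (p * q) * f (xs @ b # a # ys)"
    \<comment> \<open>Exchanging the first two arguments of \<open>f\<close> is invariance of the
      operation; any later exchange happens inside \<open>m\<close> and is commutativity.\<close>
    proof (cases xs)
      case Nil
      thus ?thesis
        using assms(11)[unfolded invariant_structure_def, rule_format, OF *(1,2,4)] len
        by (simp add: f_def)
    next
      case (Cons x zs)
      have "m (zs @ a # b # ys) = scale (parity_sign (p * q)) (m (zs @ b # a # ys))"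
        using assms(10)[unfolded super_commutative_def, rule_format, OF *(1,2) _ *(4), of zs]
          *(3) len Cons by simp
      thus ?thesis by (simp add: f_def Cons linear_map_scale[OF lin2])
    qed
  qed
  let ?\<mu> = "cls (symmetrize (1 + n) f)"
  have "sym_incl scale V (m as) = foldr (\<lambda>a s. br (sym_incl scale V a) s) as ?\<mu>"
    if "length as = n" for as
  proof -
    \<comment> \<open>After \<open>n\<close> brackets one place of \<open>f\<close> is still free,
      the left argument of \<open>B\<close>. The resulting element of degree 1 is the expansion of
      \<open>m as\<close> in the dual basis.\<close>
    have "symmetrize 1 (\<lambda>xs. f (xs @ as)) = (\<Sum>e\<in>E. const (B e (m as)) * gen (dual e))"
      by (simp add: f_def const_mult_commute[of _ "gen _"])
    also have "cls \<dots> = cls (\<Sum>e\<in>E. gen (scale (B e (m as)) (dual e)))"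
      by (rule sym_class_sum_cong) (simp add: sym_class_gen_scale)
    also have "\<dots> = cls (gen (m as))"
      by (simp only: sym_class_gen_sum[OF finite_E, symmetric] flip: expand_dual)
    finally show ?thesis
      using iterated_bracket_symmetrize[OF of_nat_Suc_neq_0_real_or_complex, of 1 as f]
        f_linear f_symmetric that
      by (simp add: sym_incl_def)
  qed
  moreover have "?\<mu> \<in> sym_power scale V (n + 1)"
    unfolding sym_power_def using keys_symmetrize(1)[of _ "1 + n" f] by auto
  ultimately show ?thesis by blast
qed

end
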